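(* Let $n\ge1$ and let $\hat a^{(i)},\hat b^{(i)},\hat a_i,\hat b_i$ $(i=1,\dots,n)$ be unit dual quaternions. The hand-eye calibration problems $$\min\Big\{\sum_{i=1}^n|\hat a^{(i)}\hat x-\hat x\hat b^{(i)}| : |\hat x|^2=1\Big\},\quad \hat x\in\hat{\mathbb Q},$$ and $$\min\Big\{\sum_{i=1}^n|\hat a_i\hat x-\hat y\hat b_i| : |\hat x|^2=1,\ |\hat y|^2=1\Big\},\quad (\hat x,\hat y)\in\hat{\mathbb Q}^2,$$ are equality constrained standard dual quaternion optimization problems; that is, the objective functions $\hat x\mapsto\sum_{i=1}^n|\hat a^{(i)}\hat x-\hat x\hat b^{(i)}|$ and $(\hat x,\hat y)\mapsto\sum_{i=1}^n|\hat a_i\hat x-\hat y\hat b_i|$, and the constraint functions $\hat x\mapsto|\hat x|^2-1$ (first problem) and $(\hat x,\hat y)\mapsto|\hat x|^2-1$, $(\hat x,\hat y)\mapsto|\hat y|^2-1$ (second problem), are all standard dual quaternion functions.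
   Context: Dual numbers: $\hat{\mathbb R}$ is the set of $q+q_d\epsilon$ with $q,q_d\in\mathbb R$, $\epsilon^2=0$; $q$ is the standard part, $q_d$ the dual part. Dual quaternions: $\hat{\mathbb Q}$ is the set of $\hat q=q+q_d\epsilon$ with $q,q_d\in\mathbb Q$, the real quaternions (note: $\mathbb Q$ denotes quaternions here), where $\epsilon$ commutes with quaternions; addition is componentwise and $(p+p_d\epsilon)(q+q_d\epsilon)=pq+(pq_d+p_dq)\epsilon$. The magnitude of $\hat q$ is the dual number $|\hat q|=|q|+\frac{qq_d^*+q_dq^*}{2|q|}\epsilon$ if $q\neq0$, and $|\hat q|=|q_d|\epsilon$ otherwise, where $q^*$ and $|q|$ are the quaternion conjugate and magnitude. $\hat q$ is a unit dual quaternion if $|\hat q|=1$. For $\hat{\mathbf x}\in\hat{\mathbb Q}^k$ write $\hat{\mathbf x}=\mathbf x+\epsilon\mathbf x_d$ with $\mathbf x,\mathbf x_d\in\mathbb Q^k$, and identify $\mathbf x$ with $\mathbf x+\epsilon\mathbf 0$. A dual quaternion function $\hat f:\hat{\mathbb Q}^k\to\hat{\mathbb R}$, $\hat f(\hat{\mathbf x})=f(\hat{\mathbf x})+\epsilon f_d(\hat{\mathbf x})$ with $f(\hat{\mathbf x}),f_d(\hat{\mathbf x})\in\mathbb R$, is standard if $f(\hat{\mathbf x})=f(\mathbf x)$ for all $\hat{\mathbf x}$. An equality constrained standard dual quaternion optimization problem is a problem $\min\{\hat f(\hat{\mathbf x}):\hat h_j(\hat{\mathbf x})=0,\ j=1,\dots,m\}$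 over $\hat{\mathbf x}\in\hat{\mathbb Q}^k$ (with respect to the order on $\hat{\mathbb R}$: $p+p_d\epsilon\le q+q_d\epsilon$ iff $p<q$, or $p=q$ and $p_d\le q_d$) in which $\hat f,\hat h_1,\dots,\hat h_m$ are all standard dual quaternion functions. *)

theory Defs
  imports Complex_Main "HOL-Analysis.Finite_Cartesian_Product" "HOL-Library.Numeral_Type"
begin

section \<open>Quaternions\<close>

datatype quat = Quat (Re0: real) (Im1: real) (Im2: real) (Im3: real)

instantiation quat :: real_algebra_1
begin

definition zero_quat :: quat where
  "0 = Quat 0 0 0 0"

definition one_quat :: quat where
  "1 = Quat 1 0 0 0"

definition plus_quat :: "quat \<Rightarrow> quat \<Rightarrow> quat" where
  "p + q = Quat (Re0 p + Re0 q) (Im1 p + Im1 q) (Im2 p + Im2 q) (Im3 p + Im3 q)"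

definition uminus_quat :: "quat \<Rightarrow> quat" where
  "- q = Quat (- Re0 q) (- Im1 q) (- Im2 q) (- Im3 q)"

definition minus_quat :: "quat \<Rightarrow> quat \<Rightarrow> quat" where
  "p - q = Quat (Re0 p - Re0 q) (Im1 p - Im1 q) (Im2 p - Im2 q) (Im3 p - Im3 q)"

definition times_quat :: "quat \<Rightarrow> quat \<Rightarrow> quat" where
  "p * q = Quat
     (Re0 p * Re0 q - Im1 p * Im1 q - Im2 p * Im2 q - Im3 p * Im3 q)
     (Re0 p * Im1 q + Im1 p * Re0 q + Im2 p * Im3 q - Im3 p * Im2 q)
     (Re0 p * Im2 q - Im1 p * Im3 q + Im2 p * Re0 q + Im3 p * Im1 q)
     (Re0 p * Im3 q + Im1 p * Im2 q - Im2 p * Im1 q + Im3 p * Re0 q)"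

definition scaleR_quat :: "real \<Rightarrow> quat \<Rightarrow> quat" where
  "r *\<^sub>R q = Quat (r * Re0 q) (r * Im1 q) (r * Im2 q) (r * Im3 q)"

instance
  by standard
    (simp_all add: zero_quat_def one_quat_def plus_quat_def uminus_quat_def minus_quat_def
      times_quat_def scaleR_quat_def algebra_simps)

end

definition qcnj :: "quat \<Rightarrow> quat" where
  "qcnj q = Quat (Re0 q) (- Im1 q) (- Im2 q) (- Im3 q)"

definition qmag :: "quat \<Rightarrow> real" where
  "qmag q = sqrt ((Re0 q)\<^sup>2 + (Im1 q)\<^sup>2 + (Im2 q)\<^sup>2 + (Im3 q)\<^sup>2)"

section \<open>Dual numbers over a ring\<close>

text \<open>\<open>Dual q r\<close> is \<open>q + r \<epsilon>\<close>. The two instances of interest are \<^typ>\<open>real\<close> (dual numbers)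
  and \<^typ>\<open>quat\<close> (dual quaternions); the ring of coefficients need not be commutative, but
  \<open>\<epsilon>\<close> is central.\<close>

datatype 'a dualnum = Dual (std_part: 'a) (dual_part: 'a)

instantiation dualnum :: (ring_1) ring_1
begin

definition zero_dualnum :: "'a dualnum" where
  "0 = Dual 0 0"

definition one_dualnum :: "'a dualnum" where
  "1 = Dual 1 0"

definition plus_dualnum :: "'a dualnum \<Rightarrow> 'a dualnum \<Rightarrow> 'a dualnum" where
  "p + q = Dual (std_part p + std_part q) (dual_part p + dual_part q)"

definition uminus_dualnum :: "'a dualnum \<Rightarrow> 'a dualnum" where
  "- q = Dual (- std_part q) (- dual_part q)"

definition minus_dualnum :: "'a dualnum \<Rightarrow> 'a dualnum \<Rightarrow> 'a dualnum" where
  "p - q = Dual (std_part p - std_part q) (dual_part p - dual_part q)"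

definition times_dualnum :: "'a dualnum \<Rightarrow> 'a dualnum \<Rightarrow> 'a dualnum" where
  "p * q = Dual (std_part p * std_part q)
     (std_part p * dual_part q + dual_part p * std_part q)"

instance
  by standard
    (simp_all add: zero_dualnum_def one_dualnum_def plus_dualnum_def uminus_dualnum_def
      minus_dualnum_def times_dualnum_def algebra_simps)

end

instantiation dualnum :: (linorder) linorder
begin

definition less_eq_dualnum :: "'a dualnum \<Rightarrow> 'a dualnum \<Rightarrow> bool" where
  "p \<le> q \<longleftrightarrow> std_part p < std_part q \<or> std_part p = std_part q \<and> dual_part p \<le> dual_part q"

definition less_dualnum :: "'a dualnum \<Rightarrow> 'a dualnum \<Rightarrow> bool" where
  "p < q \<longleftrightarrow> p \<le> q \<and> \<not> q \<le> (p :: 'a dualnum)"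

instance
  by standard (auto simp: less_eq_dualnum_def less_dualnum_def intro: dualnum.expand)

end

type_synonym dual_real = "real dualnum"
type_synonym dual_quat = "quat dualnum"

text \<open>The quaternion \<open>q q\<^sub>d\<^sup>* + q\<^sub>d q\<^sup>*\<close> is real, so taking its real part below is only a
  change of type.\<close>

lemma mag_numerator_real:
  "of_real (Re0 (q * qcnj r + r * qcnj q)) = q * qcnj r + r * qcnj q"
  by (simp add: of_real_def one_quat_def scaleR_quat_def plus_quat_def times_quat_def
      qcnj_def algebra_simps)

definition dqmag :: "dual_quat \<Rightarrow> dual_real" where
  "dqmag x = (let q = std_part x; r = dual_part x in
     if q \<noteq> 0 then Dual (qmag q) (Re0 (q * qcnj r + r * qcnj q) / (2 * qmag q))
     else Dual 0 (qmag r))"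

definition unit_dual_quat :: "dual_quat \<Rightarrow> bool" where
  "unit_dual_quat x \<longleftrightarrow> dqmag x = 1"

section \<open>Standard dual quaternion functions and optimization problems\<close>

definition std_vec :: "dual_quat ^ 'k \<Rightarrow> dual_quat ^ 'k" where
  "std_vec x = (\<chi> i. Dual (std_part (x $ i)) 0)"

definition standard_dq_function :: "(dual_quat ^ 'k \<Rightarrow> dual_real) \<Rightarrow> bool" where
  "standard_dq_function f \<longleftrightarrow> (\<forall>x. std_part (f x) = std_part (f (std_vec x)))"

text \<open>\<open>Minimize f S\<close> is the problem \<open>min {f x : x \<in> S}\<close> with respect to the order on dual
  numbers.\<close>

datatype 'k dq_problem =
  Minimize (objective: "dual_quat ^ 'k \<Rightarrow> dual_real") (feasible: "(dual_quat ^ 'k) set")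

definition minimizer :: "'k dq_problem \<Rightarrow> dual_quat ^ 'k \<Rightarrow> bool" where
  "minimizer P x \<longleftrightarrow> x \<in> feasible P \<and> (\<forall>y \<in> feasible P. objective P x \<le> objective P y)"

text \<open>The list \<open>hs\<close> consists of the constraint functions \<open>h\<^sub>1, \<dots>, h\<^sub>m\<close>.\<close>

definition eq_constrained_standard_dq_problem ::
  "'k dq_problem \<Rightarrow> (dual_quat ^ 'k \<Rightarrow> dual_real) list \<Rightarrow> bool" where
  "eq_constrained_standard_dq_problem P hs \<longleftrightarrow>
     feasible P = {x. \<forall>h \<in> set hs. h x = 0} \<and>
     standard_dq_function (objective P) \<and>
     (\<forall>h \<in> set hs. standard_dq_function h)"

end

theory Submission imports Defs begin

(* Taking standard parts is a ring homomorphism, and on magnitudes it gives the magnitude of the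
   standard part. So the standard part of any expression built from sums, products and
   magnitudes sees its arguments only through their standard parts. *)

lemma std_part_ring_hom [simp]:
  fixes p q :: "'a::ring_1 dualnum"
  shows "std_part (0 :: 'a dualnum) = 0"
    and "std_part (1 :: 'a dualnum) = 1"
    and "std_part (p + q) = std_part p + std_part q"
    and "std_part (p - q) = std_part p - std_part q"
    and "std_part (p * q) = std_part p * std_part q"
  by (simp_all add: zero_dualnum_def one_dualnum_def plus_dualnum_def minus_dualnum_def
      times_dualnum_def)

lemma std_part_power [simp]: "std_part (p ^ k) = std_part (p :: 'a::ring_1 dualnum) ^ k"
  by (induction k) simp_all

lemma std_part_sum [simp]:
  fixes f :: "'b \<Rightarrow> 'a::ring_1 dualnum"
  shows "std_part (sum f A) = (\<Sum>i\<in>A. std_part (f i))"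
  \<comment> \<open>Over an infinite \<open>A\<close> both sums are 0 by convention, so that case is
    \<open>std_part 0 = 0\<close>.\<close>
  by (induction A rule: infinite_finite_induct) simp_all

text \<open>The two branches of \<open>dqmag\<close> agree here: when the standard part vanishes,
  the value 0 is again its magnitude.\<close>

lemma std_part_dqmag [simp]: "std_part (dqmag x) = qmag (std_part x)"
  by (simp add: dqmag_def Let_def qmag_def zero_quat_def)

lemma std_part_std_vec [simp]: "std_part (std_vec x $ i) = std_part (x $ i)"
  by (simp add: std_vec_def)

theorem mainTheorem9:
  fixes n :: nat
    and a b a' b' :: "nat \<Rightarrow> dual_quat"
  assumes "n \<ge> 1"
    and "\<And>i. i \<in> {1..n} \<Longrightarrow> unit_dual_quat (a i)"
    and "\<And>i. i \<in> {1..n} \<Longrightarrow> unit_dual_quat (b i)"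
    and "\<And>i. i \<in> {1..n} \<Longrightarrow> unit_dual_quat (a' i)"
    and "\<And>i. i \<in> {1..n} \<Longrightarrow> unit_dual_quat (b' i)"
  shows
    "eq_constrained_standard_dq_problem
       (Minimize (\<lambda>x :: dual_quat ^ 1. \<Sum>i = 1..n. dqmag (a i * x $ 1 - x $ 1 * b i))
          {x. (dqmag (x $ 1))\<^sup>2 = 1})
       [\<lambda>x. (dqmag (x $ 1))\<^sup>2 - 1]
     \<and>
     eq_constrained_standard_dq_problem
       (Minimize (\<lambda>z :: dual_quat ^ 2. \<Sum>i = 1..n. dqmag (a' i * z $ 1 - z $ 2 * b' i))
          {z. (dqmag (z $ 1))\<^sup>2 = 1 \<and> (dqmag (z $ 2))\<^sup>2 = 1})
       [\<lambda>z. (dqmag (z $ 1))\<^sup>2 - 1, \<lambda>z. (dqmag (z $ 2))\<^sup>2 - 1]"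
  \<comment> \<open>The feasible sets match because \<open>u - 1 = 0\<close> iff
    \<open>u = 1\<close> in the ring of dual numbers. For standardness, the simp rules push
    \<open>std_part\<close> down to the coordinates, where \<open>x\<close> and
    \<open>std_vec x\<close> agree.\<close>
  by (simp add: eq_constrained_standard_dq_problem_def standard_dq_function_def)

end
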